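(* Let $(X,d)$ be a compact metric space, let $f:X\to\mathbb{R}$ be continuous and suppose that the sequence of equicontinuous functions $f^k:X\to\mathbb{R}$, $k\in\mathbb{N}$, satisfies $f^k(x)\le f^{k+1}(x)$ for all $x\in X$, $k\in\mathbb{N}$. Let $(x^k)_{k\in\mathbb{N}}$ be a sequence in $X$ and assume that $$\limsup_{k\to+\infty}\ f(x^k)-f^k(x^k)\le S$$ for some finite $S\ge0$. Then $$\limsup_{k\to+\infty}\ f(x^k)-f^{k-1}(x^k)\le S .$$ Moreover, $f^k$ converges uniformly to a continuous function $g$ such that $|f(y)-g(y)|\le S$ for every $y$ in the set $$Y_*=\Big\{y\in X:\ y=\lim_{j\to\infty}x^{k_j}\text{ for some subsequence }(x^{k_j})_{j\in\mathbb{N}}\Big\}.$$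
   Context: Uniform convergence is on $X$.
   Formalization: The "Moreover" part is stated under the additional assumption that f^k(x) ≤ f(x) for all x in X and all k; without it the claim fails, e.g. for f = 0 and f^k = k (no limit), or f = 0, f^k = 1, S = 0. *)

theory Defs
  imports "HOL-Analysis.Analysis"
begin

(* Pointwise equicontinuity relative to X; on a compact X it is the same as uniform equicontinuity. *)
definition equicontinuous_on ::
    "'a::metric_space set \<Rightarrow> ('i \<Rightarrow> 'a \<Rightarrow> 'b::metric_space) \<Rightarrow> bool" where
  "equicontinuous_on X F \<longleftrightarrow>
     (\<forall>x\<in>X. \<forall>e>0. \<exists>d>0. \<forall>k. \<forall>y\<in>X. dist y x < d \<longrightarrow> dist (F k y) (F k x) < e)"

(* The set Y_* of limits of convergent subsequences. It contains every value that the sequence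
   takes infinitely often, so it is larger than the set of limit points of the range. *)
definition subseq_limits :: "'a::metric_space set \<Rightarrow> (nat \<Rightarrow> 'a) \<Rightarrow> 'a set" where
  "subseq_limits X x = {y \<in> X. \<exists>r :: nat \<Rightarrow> nat. strict_mono r \<and> (x \<circ> r) \<longlonglongrightarrow> y}"

(* The uniform convergence claim of the lemma is stated for minorants, F k <= f on X. Without
   this it fails: for F k = k (constant) and f = 0 there is no limit, and for F k = 1 (constant),
   f = 0, S = 0 the limit is g = 1 and |f - g| = 1 > S. The first claim does not need it.

   Limsups are taken in ereal since they may be - infinity. The term F (k - 1) at k = 0 means F 0,
   which is irrelevant for the limsup. *)

end

theory Submission
  imports Defs
begin

text \<open>
  Everything rests on one consequence of equicontinuity: if \<open>z\<^sub>j \<rightarrow> y\<close>, then \<open>F\<^sub>n (z\<^sub>j)\<close> and \<open>F\<^sub>n (y)\<close>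
  differ by little once \<open>j\<close> is large, whatever \<open>n\<close> is. So limits along moving points
  can be computed at the fixed point \<open>y\<close> (\<open>equicontinuous_on_tendsto_diagonal\<close>), where the sequence
  \<open>F\<^sub>n (y)\<close> is monotone and hence converges as soon as it is bounded.

  For the first claim, suppose \<open>f (x\<^sub>k) - F\<^sub>k\<^sub>-\<^sub>1 (x\<^sub>k) \<ge> S + e\<close> for infinitely many \<open>k\<close>. By compactness
  these \<open>x\<^sub>k\<close> accumulate at some \<open>y\<close>. The inequality bounds \<open>F\<^sub>n (y)\<close> from above, so \<open>F\<^sub>n (y)\<close>
  converges, and then the shift of the index from \<open>k\<close> to \<open>k - 1\<close> disappears in the limit: along the
  subsequence \<open>F\<^sub>k (x\<^sub>k)\<close> and \<open>F\<^sub>k\<^sub>-\<^sub>1 (x\<^sub>k)\<close> have the same limit, contradicting the hypothesis on the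
  limit superior.

  For the second claim, monotonicity and the bound \<open>F\<^sub>n \<le> f\<close> give a pointwise limit \<open>g\<close>, which on a
  compact set is a uniform limit by equicontinuity. At a subsequential limit \<open>y\<close> of \<open>x\<close>, the values
  \<open>f (x\<^sub>k) - F\<^sub>k (x\<^sub>k)\<close> tend to \<open>f (y) - g (y)\<close> along the subsequence. This limit is at most \<open>S\<close> by
  hypothesis and nonnegative because \<open>F\<^sub>n \<le> f\<close>.
\<close>

lemma equicontinuous_on_tendsto_dist:
  assumes "equicontinuous_on X F" "y \<in> X" "\<And>j. z j \<in> X" "z \<longlonglongrightarrow> y"
  shows "(\<lambda>j. dist (F (n j) (z j)) (F (n j) y)) \<longlonglongrightarrow> 0"
proof (rule tendstoI)
  fix e :: real
  assume "e > 0"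
  then obtain d where "d > 0" and d: "\<And>k u. u \<in> X \<Longrightarrow> dist u y < d \<Longrightarrow> dist (F k u) (F k y) < e"
    using assms(1,2) unfolding equicontinuous_on_def by metis
  have "\<forall>\<^sub>F j in sequentially. dist (z j) y < d"
    using assms(4) \<open>d > 0\<close> by (rule tendstoD)
  then show "\<forall>\<^sub>F j in sequentially. dist (dist (F (n j) (z j)) (F (n j) y)) 0 < e"
    by eventually_elim (use d assms(3) in auto)
qed

lemma equicontinuous_on_tendsto_diagonal:
  assumes "equicontinuous_on X F" "y \<in> X" "\<And>j. z j \<in> X" "z \<longlonglongrightarrow> y"
    and "(\<lambda>j. F (n j) y) \<longlonglongrightarrow> l"
  shows "(\<lambda>j. F (n j) (z j)) \<longlonglongrightarrow> l"
proof (rule metric_tendsto_imp_tendsto)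
  show "(\<lambda>j. dist (F (n j) (z j)) (F (n j) y) + dist (F (n j) y) l) \<longlonglongrightarrow> 0"
    using tendsto_add[OF equicontinuous_on_tendsto_dist[OF assms(1-4)]
        tendsto_dist[OF assms(5) tendsto_const[of l]]] by simp
qed (auto intro!: always_eventually dist_triangle)

text \<open>
  The modulus of continuity at a point is common to all \<open>F k\<close>, so it survives the pointwise limit.
\<close>

lemma equicontinuous_on_imp_continuous_on_lim:
  assumes F: "equicontinuous_on X F" and g: "\<And>y. y \<in> X \<Longrightarrow> (\<lambda>k. F k y) \<longlonglongrightarrow> g y"
  shows "continuous_on X g"
  unfolding continuous_on_iff
proof (intro ballI allI impI)
  fix y and e :: real
  assume "y \<in> X" "e > 0"
  \<comment> \<open>Strict inequalities become weak ones in the limit, whence half of \<open>e\<close>.\<close>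
  then obtain d where "d > 0"
    and d: "\<And>k u. u \<in> X \<Longrightarrow> dist u y < d \<Longrightarrow> dist (F k u) (F k y) < e / 2"
    using F unfolding equicontinuous_on_def by (metis half_gt_zero)
  have "dist (g u) (g y) < e" if u: "u \<in> X" "dist u y < d" for u
  proof -
    have "dist (g u) (g y) \<le> e / 2"
      by (rule tendsto_upperbound[OF tendsto_dist[OF g[OF u(1)] g[OF \<open>y \<in> X\<close>]]])
        (use d[OF u] in \<open>simp_all add: less_imp_le\<close>)
    then show ?thesis using \<open>e > 0\<close> by simp
  qed
  then show "\<exists>d>0. \<forall>u\<in>X. dist u y < d \<longrightarrow> dist (g u) (g y) < e"
    using \<open>d > 0\<close> by blast
qed

lemma frequently_sequentially_subseq:
  assumes "\<exists>\<^sub>F k in sequentially. P k"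
  obtains s :: "nat \<Rightarrow> nat" where "strict_mono s" "\<And>j. P (s j)"
proof -
  have "infinite {k. P k}"
    using assms unfolding cofinite_eq_sequentially[symmetric] frequently_cofinite .
  from infinite_enumerate[OF this] show ?thesis
    using that by auto
qed

text \<open>
  If the convergence were not uniform, points at which \<open>F k\<close> stays away from \<open>g\<close> would accumulate at
  some \<open>y\<close>; but there both \<open>F k\<close> and \<open>g\<close> tend to \<open>g y\<close> along these points.
\<close>

lemma equicontinuous_on_imp_uniform_limit:
  assumes X: "compact X" and F: "equicontinuous_on X F"
    and g: "\<And>y. y \<in> X \<Longrightarrow> (\<lambda>k. F k y) \<longlonglongrightarrow> g y"
  shows "uniform_limit X F g sequentially"
proof (rule ccontr)
  assume "\<not> ?thesis"
  then obtain e where "e > 0"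
    and "\<exists>\<^sub>F k in sequentially. \<exists>u\<in>X. dist (F k u) (g u) \<ge> e"
    unfolding uniform_limit_iff by (auto simp: not_eventually not_less)
  from this(2) obtain s :: "nat \<Rightarrow> nat" where "strict_mono s"
    and "\<And>j. \<exists>u\<in>X. dist (F (s j) u) (g u) \<ge> e"
    by (rule frequently_sequentially_subseq) (rule that)
  then obtain u where u: "\<And>j. u j \<in> X" "\<And>j. dist (F (s j) (u j)) (g (u j)) \<ge> e"
    by metis
  obtain y t where y: "y \<in> X" and "strict_mono t" and lim: "(u \<circ> t) \<longlonglongrightarrow> y"
    using seq_compactE[of X u] X u(1) by (metis compact_imp_seq_compact)
  have inX: "(u \<circ> t) j \<in> X" for j
    using u(1) by simp
  have "strict_mono (s \<circ> t)"
    using \<open>strict_mono s\<close> \<open>strict_mono t\<close> by (rule strict_mono_o)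
  then have "(\<lambda>j. F ((s \<circ> t) j) y) \<longlonglongrightarrow> g y"
    using LIMSEQ_subseq_LIMSEQ[OF g[OF y]] by (simp add: o_def)
  then have "(\<lambda>j. F ((s \<circ> t) j) ((u \<circ> t) j)) \<longlonglongrightarrow> g y"
    by (rule equicontinuous_on_tendsto_diagonal[OF F y inX lim])
  moreover have "(\<lambda>j. g ((u \<circ> t) j)) \<longlonglongrightarrow> g y"
    by (rule continuous_on_tendsto_compose[OF equicontinuous_on_imp_continuous_on_lim[OF F g] lim])
      (use y inX in auto)
  ultimately have "(\<lambda>j. dist (F ((s \<circ> t) j) ((u \<circ> t) j)) (g ((u \<circ> t) j))) \<longlonglongrightarrow> dist (g y) (g y)"
    by (rule tendsto_dist)
  then have "dist (g y) (g y) \<ge> e"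
    by (rule tendsto_lowerbound) (use u(2) in auto)
  then show False
    using \<open>e > 0\<close> by simp
qed

lemma subseq_lim_le_limsup:
  fixes a :: "nat \<Rightarrow> real"
  assumes "limsup (\<lambda>k. ereal (a k)) \<le> ereal S" "strict_mono r" "(\<lambda>j. a (r j)) \<longlonglongrightarrow> l"
  shows "l \<le> S"
proof -
  have "ereal l = limsup ((\<lambda>k. ereal (a k)) \<circ> r)"
    using assms(3) by (intro lim_imp_Limsup[symmetric]) (auto simp: o_def)
  also have "\<dots> \<le> ereal S"
    using limsup_subseq_mono[OF assms(2)] assms(1) order_trans by blast
  finally show ?thesis by simp
qed

text \<open>
  Since \<open>n j\<close> is eventually above any given \<open>k\<close>, monotonicity turns bounds at the moving points \<open>z j\<close>
  into one bound on all \<open>F k y\<close>. This replaces an a priori bound on \<open>F\<close>: upper bounds are known only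
  along the subsequence that is supposed to violate the first claim.
\<close>

lemma equicontinuous_on_mono_convergent:
  fixes F :: "nat \<Rightarrow> 'a::metric_space \<Rightarrow> real"
  assumes F: "equicontinuous_on X F" and mono: "incseq (\<lambda>k. F k y)"
    and z: "y \<in> X" "\<And>j. z j \<in> X" "z \<longlonglongrightarrow> y"
    and n: "filterlim n at_top sequentially"
    and b: "\<And>j. F (n j) (z j) \<le> b j" "b \<longlonglongrightarrow> B"
  shows "convergent (\<lambda>k. F k y)"
proof -
  have "F k y \<le> B" for k
  proof (rule tendsto_lowerbound)
    show "(\<lambda>j. b j + dist (F (n j) (z j)) (F (n j) y)) \<longlonglongrightarrow> B"
      using tendsto_add[OF b(2) equicontinuous_on_tendsto_dist[OF F z]] by simp
    have "\<forall>\<^sub>F j in sequentially. k \<le> n j"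
      using n by (simp add: filterlim_at_top)
    then show "\<forall>\<^sub>F j in sequentially. F k y \<le> b j + dist (F (n j) (z j)) (F (n j) y)"
    proof eventually_elim
      case (elim j)
      have "F k y \<le> F (n j) y"
        using incseqD[OF mono elim] .
      then show ?case
        using b(1)[of j] by (simp add: dist_real_def)
    qed
  qed simp
  then show ?thesis
    using incseq_convergent[OF mono, of B] unfolding convergent_def by blast
qed

lemma limsup_shifted_index_le:
  fixes F :: "nat \<Rightarrow> 'a::metric_space \<Rightarrow> real"
  assumes X: "compact X" and f: "continuous_on X f" and F: "equicontinuous_on X F"
    and mono: "\<And>y. y \<in> X \<Longrightarrow> incseq (\<lambda>k. F k y)"
    and x: "\<And>k. x k \<in> X"
    and S: "limsup (\<lambda>k. ereal (f (x k) - F k (x k))) \<le> ereal S"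
  shows "limsup (\<lambda>k. ereal (f (x k) - F (k - 1) (x k))) \<le> ereal S"
proof (rule ereal_le_epsilon2, rule ccontr)
  fix e :: real
  assume "e > 0" and contra: "\<not> limsup (\<lambda>k. ereal (f (x k) - F (k - 1) (x k))) \<le> ereal S + ereal e"
  have "\<exists>\<^sub>F k in sequentially. f (x k) - F (k - 1) (x k) \<ge> S + e"
  proof (rule ccontr)
    assume "\<not> ?thesis"
    then have "\<forall>\<^sub>F k in sequentially. ereal (f (x k) - F (k - 1) (x k)) \<le> ereal S + ereal e"
      unfolding frequently_def by (auto elim: eventually_mono)
    then show False
      using contra Limsup_bounded by metis
  qed
  then obtain s :: "nat \<Rightarrow> nat" where "strict_mono s"
    and s: "\<And>j. f (x (s j)) - F (s j - 1) (x (s j)) \<ge> S + e"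
    by (rule frequently_sequentially_subseq) (rule that)
  obtain y t where y: "y \<in> X" and "strict_mono t" and lim: "(x \<circ> s \<circ> t) \<longlonglongrightarrow> y"
    using seq_compactE[of X "x \<circ> s"] X x by (metis compact_imp_seq_compact comp_apply)
  define r where "r = s \<circ> t"
  have r: "strict_mono r"
    unfolding r_def using \<open>strict_mono s\<close> \<open>strict_mono t\<close> by (rule strict_mono_o)
  have z: "(\<lambda>j. x (r j)) \<longlonglongrightarrow> y" "\<And>j. x (r j) \<in> X"
    using lim x by (simp_all add: r_def o_def)
  have fz: "(\<lambda>j. f (x (r j))) \<longlonglongrightarrow> f y"
    using f z y by (auto intro: continuous_on_tendsto_compose)
  have far: "F (r j - 1) (x (r j)) \<le> f (x (r j)) - (S + e)" for j
    using s[of "t j"] by (simp add: r_def)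
  have "convergent (\<lambda>k. F k y)"
  proof (rule equicontinuous_on_mono_convergent[OF F mono[OF y] y z(2,1) _ far])
    show "filterlim (\<lambda>j. r j - 1) at_top sequentially"
      using filterlim_compose[OF filterlim_minus_const_nat_at_top filterlim_subseq[OF r]] .
    show "(\<lambda>j. f (x (r j)) - (S + e)) \<longlonglongrightarrow> f y - (S + e)"
      using fz by (intro tendsto_intros)
  qed
  then obtain l where l: "(\<lambda>k. F k y) \<longlonglongrightarrow> l"
    by (auto simp: convergent_def)
  \<comment> \<open>At the fixed point \<open>y\<close> the shift of the index does not affect the limit.\<close>
  have "(\<lambda>k. F (k - 1) y) \<longlonglongrightarrow> l"
    by (rule LIMSEQ_imp_Suc) (use l in simp)
  then have "(\<lambda>j. F (r j - 1) (x (r j))) \<longlonglongrightarrow> l"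
    using LIMSEQ_subseq_LIMSEQ[OF _ r]
    by (intro equicontinuous_on_tendsto_diagonal[OF F y z(2,1)]) (auto simp: o_def)
  from tendsto_le[OF _ tendsto_diff[OF fz tendsto_const] this] have "l \<le> f y - (S + e)"
    using far by auto
  moreover have "(\<lambda>j. F (r j) (x (r j))) \<longlonglongrightarrow> l"
    using LIMSEQ_subseq_LIMSEQ[OF l r]
    by (intro equicontinuous_on_tendsto_diagonal[OF F y z(2,1)]) (auto simp: o_def)
  from subseq_lim_le_limsup[OF S r tendsto_diff[OF fz this]] have "f y - l \<le> S" .
  ultimately show False
    using \<open>e > 0\<close> by simp
qed

theorem lemma5p2:
  fixes X :: "'a::metric_space set"
    and f :: "'a \<Rightarrow> real"
    and F :: "nat \<Rightarrow> 'a \<Rightarrow> real"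
    and x :: "nat \<Rightarrow> 'a"
    and S :: real
  assumes "compact X"
    and "continuous_on X f"
    and "equicontinuous_on X F"
    and "\<And>k y. y \<in> X \<Longrightarrow> F k y \<le> F (Suc k) y"
    and "\<And>k. x k \<in> X"
    and "S \<ge> 0"
    and "limsup (\<lambda>k. ereal (f (x k) - F k (x k))) \<le> ereal S"
  shows "limsup (\<lambda>k. ereal (f (x k) - F (k - 1) (x k))) \<le> ereal S \<and>
         ((\<forall>k. \<forall>y\<in>X. F k y \<le> f y) \<longrightarrow>
           (\<exists>g. uniform_limit X F g sequentially \<and> continuous_on X g \<and>
                (\<forall>y\<in>subseq_limits X x. \<bar>f y - g y\<bar> \<le> S)))"
proof (intro conjI impI)
  have mono: "incseq (\<lambda>k. F k y)" if "y \<in> X" for y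
    using assms(4)[OF that] by (rule incseq_SucI)
  show "limsup (\<lambda>k. ereal (f (x k) - F (k - 1) (x k))) \<le> ereal S"
    by (rule limsup_shifted_index_le) (use assms mono in auto)
  assume le: "\<forall>k. \<forall>y\<in>X. F k y \<le> f y"
  have "\<exists>l. (\<lambda>k. F k y) \<longlonglongrightarrow> l" if "y \<in> X" for y
    using incseq_convergent[OF mono[OF that], of "f y"] le that by blast
  then obtain g where g: "\<And>y. y \<in> X \<Longrightarrow> (\<lambda>k. F k y) \<longlonglongrightarrow> g y"
    by metis
  have "\<bar>f y - g y\<bar> \<le> S" if "y \<in> subseq_limits X x" for y
  proof -
    obtain r where y: "y \<in> X" and r: "strict_mono r" and z: "(\<lambda>j. x (r j)) \<longlonglongrightarrow> y"
      using \<open>y \<in> subseq_limits X x\<close> by (auto simp: subseq_limits_def o_def)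
    have "(\<lambda>j. F (r j) (x (r j))) \<longlonglongrightarrow> g y"
      using LIMSEQ_subseq_LIMSEQ[OF g[OF y] r] assms(5)
      by (intro equicontinuous_on_tendsto_diagonal[OF assms(3) y _ z]) (auto simp: o_def)
    moreover have "(\<lambda>j. f (x (r j))) \<longlonglongrightarrow> f y"
      using assms(2,5) z y by (auto intro: continuous_on_tendsto_compose)
    ultimately have "f y - g y \<le> S"
      by (intro subseq_lim_le_limsup[OF assms(7) r] tendsto_diff)
    moreover have "g y \<le> f y"
      by (rule tendsto_upperbound[OF g[OF y]]) (use le y in auto)
    ultimately show ?thesis
      by simp
  qed
  then show "\<exists>g. uniform_limit X F g sequentially \<and> continuous_on X g \<and>
      (\<forall>y\<in>subseq_limits X x. \<bar>f y - g y\<bar> \<le> S)"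
    using equicontinuous_on_imp_uniform_limit[OF assms(1,3) g]
      equicontinuous_on_imp_continuous_on_lim[OF assms(3) g] by blast
qed

end
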